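(* Let $(X_n)_{n\in\mathbb N}$ be a sequence of Banach spaces, let $0<\alpha<2$ and let $\mathcal U$ be a free ultrafilter over $\mathbb N$. Assume that for every $\delta>0$ there exists $n\in\mathbb N$ such that $$\{k\in\mathbb N: C_n^\alpha(X_k)<\delta\}\in\mathcal U.$$ Then every slice of the closed unit ball of $(X_n)_{\mathcal U}$ contains two points at distance at least $\alpha$.
   Context: Banach spaces are over the scalar field $\mathbb R$ or $\mathbb C$ and are assumed non-zero. For a Banach space $X$, $B_X$ and $S_X$ denote the closed unit ball and the unit sphere, and $X^*$ the topological dual. A slice of $B_X$ is a set of the form $\{x\in B_X: \operatorname{Re} f(x)>\sup_{y\in B_X} \operatorname{Re} f(y)-\beta\}$ with $f\in X^*$ and $\beta>0$. For $n\in\mathbb N$ and a subset $C$ of $X$, $\operatorname{conv}_n(C):=\{\sum_{i=1}^n\lambda_i x_i: \lambda_1,\ldots,\lambda_n\in[0,1],\ \sum_{i=1}^n\lambda_i=1,\ x_1,\ldots,x_n\in C\}$. For $\alpha>0$ and $n\in\mathbb N$ put $$S^\alpha(X):=\left\{\tfrac{x+y}{2}: x,y\in B_X,\ \Vert x-y\Vert\geq\alpha\right\},\qquad S_n^\alpha(X):=\operatorname{conv}_n(S^\alpha(X)),$$ $$C_n^\alpha(X):=\sup_{x\in S_X}\ \inf_{y\in S_n^\alpha(X)}\Vert x-y\Vert.$$ Given Banach spaces $X_n$ ($n\in\mathbb N$) and a free ultrafilter $\mathcal U$ over $\mathbb N$, the ultraproduct is the quotient Banach space $(X_n)_{\mathcal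 U}:=\ell_\infty(\mathbb N,X_n)/c_{0,\mathcal U}(\mathbb N,X_n)$, where $\ell_\infty(\mathbb N,X_n)$ is the space of all sequences $(x_n)$ with $x_n\in X_n$ and $\sup_n\Vert x_n\Vert<\infty$ (sup norm), and $c_{0,\mathcal U}(\mathbb N,X_n)$ is the subspace of those with $\lim_{\mathcal U}\Vert x_n\Vert=0$. The norm satisfies $\Vert(x_n)_{\mathcal U}\Vert=\lim_{\mathcal U}\Vert x_n\Vert$. *)

theory Defs
  imports "HOL-Analysis.Analysis" "HOL-Algebra.Module" "HOL-Algebra.AbelCoset"
begin

section \<open>Banach spaces with explicit carriers\<close>

text \<open>
  The members of a sequence of Banach spaces are unrelated to each other, so a space is a
  record (an HOL-Algebra module with a norm) and not a type of class \<open>banach\<close>. The ring fields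
  \<open>mult\<close> and \<open>one\<close>, which the module record inherits, play no role and are left unspecified.

  The scalars are a set \<open>K\<close> of complex numbers, either \<open>\<real>\<close> or all of them; scalar multiplication
  is only meaningful for scalars in \<open>K\<close>.
\<close>

record 'a normed_module = "(complex, 'a) module" +
  nrm :: "'a \<Rightarrow> real"

definition scalar_ring :: "complex set \<Rightarrow> complex ring" where
  "scalar_ring K = \<lparr>carrier = K, mult = (*), one = 1, zero = 0, add = (+)\<rparr>"

definition ndist :: "'a normed_module \<Rightarrow> 'a \<Rightarrow> 'a \<Rightarrow> real" where
  "ndist M x y = nrm M (x \<ominus>\<^bsub>M\<^esub> y)"

locale normed_space = Module.module "scalar_ring K" M
  for K :: "complex set" and M :: "'a normed_module" (structure) +
  assumes scalars: "K = \<real> \<or> K = UNIV"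
    and nrm_nonneg: "x \<in> carrier M \<Longrightarrow> 0 \<le> nrm M x"
    and nrm_eq_0_iff: "x \<in> carrier M \<Longrightarrow> nrm M x = 0 \<longleftrightarrow> x = \<zero>\<^bsub>M\<^esub>"
    and nrm_smult: "c \<in> K \<Longrightarrow> x \<in> carrier M \<Longrightarrow> nrm M (c \<odot>\<^bsub>M\<^esub> x) = cmod c * nrm M x"
    and nrm_triangle:
      "x \<in> carrier M \<Longrightarrow> y \<in> carrier M \<Longrightarrow> nrm M (x \<oplus>\<^bsub>M\<^esub> y) \<le> nrm M x + nrm M y"

locale banach_space = normed_space +
  assumes complete: "Metric_space.mcomplete (carrier M) (ndist M)"

definition unit_ball :: "'a normed_module \<Rightarrow> 'a set" where
  "unit_ball M = {x \<in> carrier M. nrm M x \<le> 1}"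

definition unit_sphere :: "'a normed_module \<Rightarrow> 'a set" where
  "unit_sphere M = {x \<in> carrier M. nrm M x = 1}"

text \<open>Only the values of a functional on the carrier matter.\<close>

definition dual :: "complex set \<Rightarrow> 'a normed_module \<Rightarrow> ('a \<Rightarrow> complex) set" where
  "dual K M = {f. (\<forall>x\<in>carrier M. f x \<in> K)
     \<and> (\<forall>x\<in>carrier M. \<forall>y\<in>carrier M. f (x \<oplus>\<^bsub>M\<^esub> y) = f x + f y)
     \<and> (\<forall>c\<in>K. \<forall>x\<in>carrier M. f (c \<odot>\<^bsub>M\<^esub> x) = c * f x)
     \<and> (\<exists>B. \<forall>x\<in>carrier M. cmod (f x) \<le> B * nrm M x)}"

definition slices :: "complex set \<Rightarrow> 'a normed_module \<Rightarrow> 'a set set" where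
  "slices K M = {{x \<in> unit_ball M. Re (f x) > (SUP y\<in>unit_ball M. Re (f y)) - \<beta>} | f \<beta>.
     f \<in> dual K M \<and> \<beta> > 0}"


section \<open>The quantity \<open>C\<^sub>n\<^sup>\<alpha>(X)\<close>\<close>

definition conv_n :: "'a normed_module \<Rightarrow> nat \<Rightarrow> 'a set \<Rightarrow> 'a set" where
  "conv_n M n C = {(\<Oplus>\<^bsub>M\<^esub>i\<in>{1..n}. complex_of_real (l i) \<odot>\<^bsub>M\<^esub> x i) | (l :: nat \<Rightarrow> real) x.
     (\<forall>i\<in>{1..n}. l i \<in> {0..1} \<and> x i \<in> C) \<and> (\<Sum>i=1..n. l i) = 1}"

definition S_set :: "real \<Rightarrow> 'a normed_module \<Rightarrow> 'a set" where
  "S_set \<alpha> M = {(1/2) \<odot>\<^bsub>M\<^esub> (x \<oplus>\<^bsub>M\<^esub> y) | x y.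
     x \<in> unit_ball M \<and> y \<in> unit_ball M \<and> ndist M x y \<ge> \<alpha>}"

definition S_n_set :: "nat \<Rightarrow> real \<Rightarrow> 'a normed_module \<Rightarrow> 'a set" where
  "S_n_set n \<alpha> M = conv_n M n (S_set \<alpha> M)"

text \<open>
  For \<open>n \<ge> 1\<close>, \<open>\<alpha> \<le> 2\<close> and a non-zero space, \<open>S_n_set n \<alpha> M\<close> contains \<open>\<zero>\<close> (the midpoint of
  \<open>x\<close> and \<open>-x\<close> with \<open>x\<close> on the sphere), so the infima and the supremum below are those of
  non-empty bounded sets of reals, with values in \<open>[0,1]\<close>. For \<open>n = 0\<close> the set is empty.
\<close>

definition C_const :: "nat \<Rightarrow> real \<Rightarrow> 'a normed_module \<Rightarrow> real" where
  "C_const n \<alpha> M = (SUP x\<in>unit_sphere M. INF y\<in>S_n_set n \<alpha> M. ndist M x y)"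


section \<open>Ultraproducts\<close>

text \<open>A set \<open>A\<close> belongs to the filter \<open>U\<close> when \<open>\<forall>\<^sub>F k in U. k \<in> A\<close>.\<close>

definition ultrafilter :: "'i filter \<Rightarrow> bool" where
  "ultrafilter U \<longleftrightarrow> U \<noteq> bot \<and> (\<forall>P. eventually P U \<or> eventually (\<lambda>k. \<not> P k) U)"

definition free_ultrafilter :: "'i filter \<Rightarrow> bool" where
  "free_ultrafilter U \<longleftrightarrow> ultrafilter U \<and> (\<forall>j. \<not> eventually (\<lambda>k. k = j) U)"

definition linfty :: "(nat \<Rightarrow> 'a normed_module) \<Rightarrow> (nat \<Rightarrow> 'a) normed_module" where
  "linfty X = \<lparr>
     carrier = {x. (\<forall>k. x k \<in> carrier (X k)) \<and> bdd_above (range (\<lambda>k. nrm (X k) (x k)))},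
     mult = undefined, one = undefined,
     zero = (\<lambda>k. \<zero>\<^bsub>X k\<^esub>),
     add = (\<lambda>x y k. x k \<oplus>\<^bsub>X k\<^esub> y k),
     smult = (\<lambda>c x k. c \<odot>\<^bsub>X k\<^esub> x k),
     nrm = (\<lambda>x. SUP k. nrm (X k) (x k))\<rparr>"

definition c0_along :: "nat filter \<Rightarrow> (nat \<Rightarrow> 'a normed_module) \<Rightarrow> (nat \<Rightarrow> 'a) set" where
  "c0_along U X = {x \<in> carrier (linfty X). ((\<lambda>k. nrm (X k) (x k)) \<longlongrightarrow> 0) U}"

text \<open>
  The quotient of \<open>M\<close> by a closed subspace \<open>N\<close>, with the quotient norm. The union in \<open>smult\<close>
  is over equal cosets; it makes \<open>0 \<cdot> A\<close> the coset \<open>N\<close>, where the pointwise image would be \<open>{\<zero>}\<close>.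
\<close>

definition quotient_space :: "'a normed_module \<Rightarrow> 'a set \<Rightarrow> 'a set normed_module" where
  "quotient_space M N = \<lparr>
     carrier = a_rcosets\<^bsub>M\<^esub> N,
     mult = undefined, one = undefined,
     zero = N,
     add = (\<lambda>A B. A <+>\<^bsub>M\<^esub> B),
     smult = (\<lambda>c A. \<Union>x\<in>A. N +>\<^bsub>M\<^esub> (c \<odot>\<^bsub>M\<^esub> x)),
     nrm = (\<lambda>A. INF x\<in>A. nrm M x)\<rparr>"

definition ultraproduct ::
  "nat filter \<Rightarrow> (nat \<Rightarrow> 'a normed_module) \<Rightarrow> (nat \<Rightarrow> 'a) set normed_module" where
  "ultraproduct U X = quotient_space (linfty X) (c0_along U X)"

end

theory Submission
  imports Defs
begin

text \<open>
  Every element of the ultraproduct is the class of a bounded sequence, and the norm of a class is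
  the limit of the norms along the ultrafilter. Fix a functional \<open>f\<close>, let \<open>s\<close> be the supremum of
  \<open>Re f\<close> on the unit ball, and let \<open>\<beta> > 0\<close>. Choose a point of the ball at which \<open>Re f\<close> is close to
  \<open>s\<close>; after a normalisation it is the class of a sequence \<open>x\<close> with every \<open>x k\<close> on the unit
  sphere of \<open>X k\<close> (\<open>sphere_representative\<close>). For a small \<open>\<delta>\<close>, the hypothesis gives a single \<open>n\<close>
  such that, for almost all \<open>k\<close>, the point \<open>x k\<close> is within \<open>\<delta>\<close> of a convex combination \<open>y k\<close> of
  \<open>n\<close> midpoints of pairs of ball points at distance at least \<open>\<alpha>\<close>.

  The number of summands does not depend on \<open>k\<close>, so the convex structure passes to the limit: each
  of the \<open>n\<close> sequences of coefficients converges along the ultrafilter, and the class of \<open>y\<close> is the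
  convex combination, with the limit coefficients, of the classes of the \<open>n\<close> sequences of midpoints
  (\<open>S_n_set_sequence\<close>). Since \<open>Re f\<close> exceeds \<open>s - \<beta>/2\<close> at the class of \<open>y\<close>, it does so at one of
  these \<open>n\<close> classes. That class is the midpoint of the classes \<open>u\<close>, \<open>v\<close> of two sequences in the unit
  balls whose coordinates are at distance at least \<open>\<alpha>\<close>, hence \<open>\<parallel>u - v\<parallel> \<ge> \<alpha>\<close>. Finally
  \<open>Re f u + Re f v > 2 s - \<beta>\<close> while both terms are at most \<open>s\<close>, so both exceed \<open>s - \<beta>\<close> and both
  points lie in the slice.
\<close>

section \<open>Normed spaces\<close>

context normed_space
begin

lemma carrier_scalar_ring: "carrier (scalar_ring K) = K"
  by (simp add: scalar_ring_def)

lemma of_real_scalar [simp, intro]: "complex_of_real r \<in> K"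
  using scalars by auto

lemma minus_one_scalar [simp, intro]: "- 1 \<in> K"
  using of_real_scalar[of "-1"] by simp

lemma half_scalar [simp, intro]: "1/2 \<in> K"
  using of_real_scalar[of "1/2"] by simp

lemma one_scalar [simp, intro]: "1 \<in> K"
  using of_real_scalar[of 1] by simp

lemma smult_carrier [simp, intro]: "c \<in> K \<Longrightarrow> x \<in> carrier M \<Longrightarrow> c \<odot>\<^bsub>M\<^esub> x \<in> carrier M"
  using smult_closed[of c x] by (simp add: carrier_scalar_ring)

lemma smult_add_left:
  "a \<in> K \<Longrightarrow> b \<in> K \<Longrightarrow> x \<in> carrier M \<Longrightarrow> (a + b) \<odot>\<^bsub>M\<^esub> x = a \<odot>\<^bsub>M\<^esub> x \<oplus>\<^bsub>M\<^esub> b \<odot>\<^bsub>M\<^esub> x"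
  using smult_l_distr[of a b x] by (simp add: scalar_ring_def)

lemma smult_add_right:
  "a \<in> K \<Longrightarrow> x \<in> carrier M \<Longrightarrow> y \<in> carrier M \<Longrightarrow> a \<odot>\<^bsub>M\<^esub> (x \<oplus>\<^bsub>M\<^esub> y) = a \<odot>\<^bsub>M\<^esub> x \<oplus>\<^bsub>M\<^esub> a \<odot>\<^bsub>M\<^esub> y"
  using smult_r_distr[of a x y] by (simp add: scalar_ring_def)

lemma smult_mult:
  "a \<in> K \<Longrightarrow> b \<in> K \<Longrightarrow> x \<in> carrier M \<Longrightarrow> (a * b) \<odot>\<^bsub>M\<^esub> x = a \<odot>\<^bsub>M\<^esub> (b \<odot>\<^bsub>M\<^esub> x)"
  using smult_assoc1[of a b x] by (simp add: scalar_ring_def)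

lemma one_smult [simp]: "x \<in> carrier M \<Longrightarrow> 1 \<odot>\<^bsub>M\<^esub> x = x"
  using smult_one[of x] by (simp add: scalar_ring_def)

lemma zero_smult [simp]: "x \<in> carrier M \<Longrightarrow> 0 \<odot>\<^bsub>M\<^esub> x = \<zero>\<^bsub>M\<^esub>"
  using smult_l_null[of x] by (simp add: scalar_ring_def)

lemma minus_eq_smult:
  assumes x: "x \<in> carrier M"
  shows "\<ominus>\<^bsub>M\<^esub> x = (- 1) \<odot>\<^bsub>M\<^esub> x"
proof -
  have "(- 1) \<odot>\<^bsub>M\<^esub> x \<oplus>\<^bsub>M\<^esub> x = \<zero>\<^bsub>M\<^esub>"
    using smult_add_left[of "-1" 1 x] x by simp
  then show ?thesis
    by (intro M.minus_equality) (use x in auto)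
qed

lemma smult_diff_left_of_real:
  assumes x: "x \<in> carrier M"
  shows "complex_of_real a \<odot>\<^bsub>M\<^esub> x \<ominus>\<^bsub>M\<^esub> complex_of_real b \<odot>\<^bsub>M\<^esub> x = complex_of_real (a - b) \<odot>\<^bsub>M\<^esub> x"
proof -
  have "\<ominus>\<^bsub>M\<^esub> (complex_of_real b \<odot>\<^bsub>M\<^esub> x) = complex_of_real (- b) \<odot>\<^bsub>M\<^esub> x"
    using x smult_mult[of "- 1" "complex_of_real b" x] by (simp add: minus_eq_smult)
  then show ?thesis
    using smult_add_left[OF of_real_scalar of_real_scalar x, of a "- b"] by (simp add: a_minus_def)
qed

lemma nrm_zero [simp]: "nrm M \<zero>\<^bsub>M\<^esub> = 0"
  by (simp add: nrm_eq_0_iff)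

lemma nrm_minus: "x \<in> carrier M \<Longrightarrow> nrm M (\<ominus>\<^bsub>M\<^esub> x) = nrm M x"
  by (simp add: minus_eq_smult nrm_smult)

lemma nrm_diff_le: "x \<in> carrier M \<Longrightarrow> y \<in> carrier M \<Longrightarrow> nrm M (x \<ominus>\<^bsub>M\<^esub> y) \<le> nrm M x + nrm M y"
  using nrm_triangle[of x "\<ominus>\<^bsub>M\<^esub> y"] by (simp add: a_minus_def nrm_minus)

lemma S_set_unit_ball: "S_set \<alpha> M \<subseteq> unit_ball M"
proof
  fix w assume "w \<in> S_set \<alpha> M"
  then obtain u v where uv: "u \<in> carrier M" "v \<in> carrier M" "nrm M u \<le> 1" "nrm M v \<le> 1"
    and w: "w = (1/2) \<odot>\<^bsub>M\<^esub> (u \<oplus>\<^bsub>M\<^esub> v)"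
    by (auto simp: S_set_def unit_ball_def)
  have "nrm M w = 1/2 * nrm M (u \<oplus>\<^bsub>M\<^esub> v)"
    unfolding w using nrm_smult[OF half_scalar M.a_closed[OF uv(1,2)]] by (simp add: norm_divide)
  then show "w \<in> unit_ball M"
    using uv nrm_triangle[OF uv(1,2)] by (simp add: unit_ball_def w)
qed

lemma S_n_set_carrier: "S_n_set n \<alpha> M \<subseteq> carrier M"
proof
  fix y assume "y \<in> S_n_set n \<alpha> M"
  then obtain l x where y: "y = (\<Oplus>\<^bsub>M\<^esub>i\<in>{1..n}. complex_of_real (l i) \<odot>\<^bsub>M\<^esub> x i)"
    and x: "\<forall>i\<in>{1..n}. x i \<in> S_set \<alpha> M"
    by (auto simp: S_n_set_def conv_n_def)
  show "y \<in> carrier M"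
    unfolding y using x S_set_unit_ball by (intro M.finsum_closed) (auto simp: unit_ball_def)
qed

lemma unit_sphere_nonempty:
  assumes "carrier M \<noteq> {\<zero>\<^bsub>M\<^esub>}"
  shows "unit_sphere M \<noteq> {}"
proof -
  obtain x where x: "x \<in> carrier M" "x \<noteq> \<zero>\<^bsub>M\<^esub>"
    using assms by blast
  then have pos: "nrm M x \<noteq> 0"
    by (simp add: nrm_eq_0_iff)
  let ?e = "complex_of_real (inverse (nrm M x)) \<odot>\<^bsub>M\<^esub> x"
  have "nrm M ?e = 1"
    using nrm_smult[OF of_real_scalar x(1), of "inverse (nrm M x)"] pos nrm_nonneg[OF x(1)]
    by (simp del: of_real_inverse)
  then have "?e \<in> unit_sphere M"
    unfolding unit_sphere_def using x by blast
  then show ?thesis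
    by blast
qed

text \<open>
  For a unit vector \<open>e\<close>, the midpoint of \<open>e\<close> and \<open>-e\<close> belongs to \<open>S_set \<alpha> M\<close>, as these two points
  are at distance \<open>2\<close>.
\<close>

lemma S_n_set_nonempty:
  assumes "carrier M \<noteq> {\<zero>\<^bsub>M\<^esub>}" "\<alpha> \<le> 2" "1 \<le> n"
  shows "S_n_set n \<alpha> M \<noteq> {}"
proof -
  obtain e where e: "e \<in> carrier M" "nrm M e = 1"
    using unit_sphere_nonempty[OF assms(1)] by (auto simp: unit_sphere_def)
  have "e \<ominus>\<^bsub>M\<^esub> (\<ominus>\<^bsub>M\<^esub> e) = 2 \<odot>\<^bsub>M\<^esub> e"
    using e smult_add_left[of 1 1 e] by (simp add: a_minus_def)
  moreover have "2 \<in> K"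
    using of_real_scalar[of 2] by simp
  ultimately have "ndist M e (\<ominus>\<^bsub>M\<^esub> e) = 2"
    using e nrm_smult[of 2 e] by (simp add: ndist_def)
  then have "(1/2) \<odot>\<^bsub>M\<^esub> (e \<oplus>\<^bsub>M\<^esub> (\<ominus>\<^bsub>M\<^esub> e)) \<in> S_set \<alpha> M"
    unfolding S_set_def using e assms(2) nrm_minus[of e]
    by (intro CollectI exI[of _ e] exI[of _ "\<ominus>\<^bsub>M\<^esub> e"]) (auto simp: unit_ball_def)
  then obtain w where w: "w \<in> S_set \<alpha> M" by blast
  have "(\<Oplus>\<^bsub>M\<^esub>i\<in>{1..n}. complex_of_real ((\<lambda>_. 1 / real n) i) \<odot>\<^bsub>M\<^esub> (\<lambda>_. w) i) \<in> S_n_set n \<alpha> M"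
    unfolding S_n_set_def conv_n_def
    by (intro CollectI exI[of _ "\<lambda>_. 1 / real n"] exI[of _ "\<lambda>_. w"]) (use w assms(3) in auto)
  then show ?thesis by blast
qed

text \<open>
  The supremum and the infimum in \<open>C_const\<close> are conditional ones on the reals: the infimum bounds
  nothing unless \<open>S_n_set n \<alpha> M\<close> is non-empty, and the supremum dominates its terms only because
  they are bounded by the distance to one fixed point of that set.
\<close>

lemma C_const_approx:
  assumes "carrier M \<noteq> {\<zero>\<^bsub>M\<^esub>}" "\<alpha> \<le> 2" "1 \<le> n"
    and less: "C_const n \<alpha> M < \<delta>" and x: "x \<in> unit_sphere M"
  shows "\<exists>y\<in>S_n_set n \<alpha> M. ndist M x y < \<delta>"
proof -
  let ?d = "\<lambda>x. INF y\<in>S_n_set n \<alpha> M. ndist M x y"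
  obtain y0 where y0: "y0 \<in> S_n_set n \<alpha> M"
    using S_n_set_nonempty assms by blast
  have nonneg: "0 \<le> ndist M x y" if "x \<in> unit_sphere M" "y \<in> S_n_set n \<alpha> M" for x y
    using that S_n_set_carrier[of n \<alpha>] by (auto simp: ndist_def unit_sphere_def intro!: nrm_nonneg)
  have "?d x \<le> 1 + nrm M y0" if x: "x \<in> unit_sphere M" for x
  proof -
    have "?d x \<le> ndist M x y0"
      by (intro cINF_lower y0 bdd_belowI2[of _ 0] nonneg x)
    also have "\<dots> \<le> 1 + nrm M y0"
      using nrm_diff_le[of x y0] x y0 S_n_set_carrier[of n \<alpha>] by (auto simp: ndist_def unit_sphere_def)
    finally show ?thesis .
  qed
  then have "?d x \<le> C_const n \<alpha> M"
    unfolding C_const_def by (intro cSUP_upper x bdd_aboveI2)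
  with less have "Inf (ndist M x ` S_n_set n \<alpha> M) < \<delta>" by simp
  from cInf_lessD[OF _ this] y0 show ?thesis by blast
qed

end


section \<open>Cosets in a quotient space\<close>

context module
begin

lemma submodule_abelian_subgroup: "submodule N R M \<Longrightarrow> abelian_subgroup N M"
  by (intro abelian_subgroupI3 additive_subgroupI M.abelian_group_axioms submodule.axioms(1))

end

context
  fixes R :: "complex ring" and M :: "'a normed_module" and N :: "'a set"
  assumes M: "module R M" and N: "submodule N R M"
begin

interpretation module R M by (rule M)
interpretation N: abelian_subgroup N M by (rule submodule_abelian_subgroup[OF N])
lemma coset_in_quotient_space: "x \<in> carrier M \<Longrightarrow> N +>\<^bsub>M\<^esub> x \<in> carrier (quotient_space M N)"
  using a_rcosetsI[OF N.a_subset] by (simp add: quotient_space_def)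

lemma quotient_space_cosetE:
  assumes "A \<in> carrier (quotient_space M N)"
  obtains x where "x \<in> carrier M" "A = N +>\<^bsub>M\<^esub> x"
  using assms by (auto simp: quotient_space_def A_RCOSETS_def')

lemma coset_add:
  "x \<in> carrier M \<Longrightarrow> y \<in> carrier M \<Longrightarrow>
    (N +>\<^bsub>M\<^esub> x) \<oplus>\<^bsub>quotient_space M N\<^esub> (N +>\<^bsub>M\<^esub> y) = N +>\<^bsub>M\<^esub> (x \<oplus>\<^bsub>M\<^esub> y)"
  using N.a_rcos_sum by (simp add: quotient_space_def)

lemma coset_zero: "N +>\<^bsub>M\<^esub> \<zero>\<^bsub>M\<^esub> = \<zero>\<^bsub>quotient_space M N\<^esub>"
  using M.a_coset_add_zero[OF N.a_subset] by (simp add: quotient_space_def)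

lemma quotient_space_abelian_group: "abelian_group (quotient_space M N)"
proof -
  let ?Q = "quotient_space M N"
  note coset = coset_in_quotient_space
  have ex: "(\<exists>A\<in>carrier ?Q. P A) \<longleftrightarrow> (\<exists>x\<in>carrier M. P (N +>\<^bsub>M\<^esub> x))" for P
    using quotient_space_cosetE coset by metis
  have all: "(\<forall>A\<in>carrier ?Q. P A) \<longleftrightarrow> (\<forall>x\<in>carrier M. P (N +>\<^bsub>M\<^esub> x))" for P
    using quotient_space_cosetE coset by metis
  have "\<forall>A\<in>carrier ?Q. \<forall>B\<in>carrier ?Q. A \<oplus>\<^bsub>?Q\<^esub> B \<in> carrier ?Q \<and> A \<oplus>\<^bsub>?Q\<^esub> B = B \<oplus>\<^bsub>?Q\<^esub> A"
    unfolding all by (simp add: coset_add coset M.a_comm)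
  moreover have "\<forall>A\<in>carrier ?Q. \<forall>B\<in>carrier ?Q. \<forall>C\<in>carrier ?Q.
      A \<oplus>\<^bsub>?Q\<^esub> B \<oplus>\<^bsub>?Q\<^esub> C = A \<oplus>\<^bsub>?Q\<^esub> (B \<oplus>\<^bsub>?Q\<^esub> C)"
    unfolding all by (simp add: coset_add M.a_assoc)
  moreover have "\<forall>A\<in>carrier ?Q. \<zero>\<^bsub>?Q\<^esub> \<oplus>\<^bsub>?Q\<^esub> A = A \<and> (\<exists>B\<in>carrier ?Q. B \<oplus>\<^bsub>?Q\<^esub> A = \<zero>\<^bsub>?Q\<^esub>)"
    unfolding all ex coset_zero[symmetric]
  proof (intro ballI conjI bexI)
    fix x assume x: "x \<in> carrier M"
    show "(N +>\<^bsub>M\<^esub> \<zero>\<^bsub>M\<^esub>) \<oplus>\<^bsub>?Q\<^esub> (N +>\<^bsub>M\<^esub> x) = N +>\<^bsub>M\<^esub> x"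
      unfolding coset_add[OF M.zero_closed x] M.l_zero[OF x] ..
    show "(N +>\<^bsub>M\<^esub> (\<ominus>\<^bsub>M\<^esub> x)) \<oplus>\<^bsub>?Q\<^esub> (N +>\<^bsub>M\<^esub> x) = N +>\<^bsub>M\<^esub> \<zero>\<^bsub>M\<^esub>"
      unfolding coset_add[OF M.a_inv_closed[OF x] x] M.l_neg[OF x] ..
    show "\<ominus>\<^bsub>M\<^esub> x \<in> carrier M"
      by (rule M.a_inv_closed[OF x])
  qed
  moreover have "\<zero>\<^bsub>?Q\<^esub> \<in> carrier ?Q"
    unfolding coset_zero[symmetric] by (rule coset[OF M.zero_closed])
  ultimately show ?thesis
    by (intro abelian_groupI) blast+
qed

interpretation Q: abelian_group "quotient_space M N"
  by (rule quotient_space_abelian_group)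

lemma coset_diff:
  assumes "x \<in> carrier M" "y \<in> carrier M"
  shows "(N +>\<^bsub>M\<^esub> x) \<ominus>\<^bsub>quotient_space M N\<^esub> (N +>\<^bsub>M\<^esub> y) = N +>\<^bsub>M\<^esub> (x \<ominus>\<^bsub>M\<^esub> y)"
proof -
  have y': "\<ominus>\<^bsub>M\<^esub> y \<in> carrier M"
    by (rule M.a_inv_closed[OF assms(2)])
  have "\<ominus>\<^bsub>quotient_space M N\<^esub> (N +>\<^bsub>M\<^esub> y) = N +>\<^bsub>M\<^esub> (\<ominus>\<^bsub>M\<^esub> y)"
  proof (rule Q.minus_equality)
    show "(N +>\<^bsub>M\<^esub> (\<ominus>\<^bsub>M\<^esub> y)) \<oplus>\<^bsub>quotient_space M N\<^esub> (N +>\<^bsub>M\<^esub> y) = \<zero>\<^bsub>quotient_space M N\<^esub>"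
      unfolding coset_add[OF y' assms(2)] M.l_neg[OF assms(2)] by (rule coset_zero)
  qed (rule coset_in_quotient_space, fact)+
  then show ?thesis
    unfolding a_minus_def by (simp only: coset_add[OF assms(1) y'])
qed

lemma coset_eqI:
  assumes x: "x \<in> carrier M" and y: "y \<in> carrier M" and diff: "x \<ominus>\<^bsub>M\<^esub> y \<in> N"
  shows "N +>\<^bsub>M\<^esub> x = N +>\<^bsub>M\<^esub> y"
proof -
  have "x \<in> N +>\<^bsub>M\<^esub> y"
    using diff unfolding N.a_rcos_module[OF y x] a_minus_def .
  then show ?thesis
    using N.a_repr_independence'[OF _ y] by simp
qed

text \<open>
  The scalar multiple of a coset is defined as a union over its representatives; it collapses to one
  coset because \<open>N\<close> is closed under scalar multiplication.
\<close>

lemma coset_smult: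
  assumes c: "c \<in> carrier R" and x: "x \<in> carrier M"
  shows "c \<odot>\<^bsub>quotient_space M N\<^esub> (N +>\<^bsub>M\<^esub> x) = N +>\<^bsub>M\<^esub> (c \<odot>\<^bsub>M\<^esub> x)"
proof -
  have coset_indep: "N +>\<^bsub>M\<^esub> (c \<odot>\<^bsub>M\<^esub> y) = N +>\<^bsub>M\<^esub> (c \<odot>\<^bsub>M\<^esub> x)" if "y \<in> N +>\<^bsub>M\<^esub> x" for y
  proof -
    have y: "y \<in> carrier M"
      using N.a_elemrcos_carrier[OF x that] .
    have "c \<odot>\<^bsub>M\<^esub> y \<ominus>\<^bsub>M\<^esub> c \<odot>\<^bsub>M\<^esub> x = c \<odot>\<^bsub>M\<^esub> (y \<oplus>\<^bsub>M\<^esub> \<ominus>\<^bsub>M\<^esub> x)"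
      unfolding a_minus_def smult_r_distr[OF c y M.a_inv_closed[OF x]] smult_r_minus[OF c x] ..
    also have "\<dots> \<in> N"
      using that unfolding N.a_rcos_module[OF x y] by (rule submodule.smult_closed[OF N c])
    finally show ?thesis
      by (rule coset_eqI[OF smult_closed[OF c y] smult_closed[OF c x]])
  qed
  have "c \<odot>\<^bsub>quotient_space M N\<^esub> (N +>\<^bsub>M\<^esub> x) = (\<Union>y\<in>N +>\<^bsub>M\<^esub> x. N +>\<^bsub>M\<^esub> (c \<odot>\<^bsub>M\<^esub> y))"
    by (simp add: quotient_space_def)
  also have "\<dots> = N +>\<^bsub>M\<^esub> (c \<odot>\<^bsub>M\<^esub> x)"
    by (rule UN_constant_eq[OF N.a_rcos_self[OF x]], rule ballI, rule coset_indep)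
  finally show ?thesis .
qed

end


section \<open>Limits along an ultrafilter\<close>

text \<open>
  By compactness the image filter has a cluster point \<open>L\<close> in \<open>{-B..B}\<close>. An ultrafilter converges to
  each of its cluster points: if it did not contain a neighbourhood of \<open>L\<close>, it would contain the
  complement.
\<close>

lemma ultrafilter_bounded_tendsto:
  fixes g :: "'i \<Rightarrow> real"
  assumes U: "ultrafilter U" and g: "\<And>k. \<bar>g k\<bar> \<le> B"
  shows "\<exists>L. (g \<longlongrightarrow> L) U"
proof -
  have "filtermap g U \<noteq> bot"
    using U by (simp add: ultrafilter_def filtermap_bot_iff)
  moreover have "eventually (\<lambda>x. x \<in> {-B..B}) (filtermap g U)"
    using g by (auto simp: eventually_filtermap abs_le_iff minus_le_iff intro!: always_eventually)
  moreover have "compact {-B..B}"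
    by (rule compact_Icc)
  ultimately obtain L where L: "inf (nhds L) (filtermap g U) \<noteq> bot"
    unfolding compact_filter by blast
  have "eventually P (filtermap g U)" if P: "eventually P (nhds L)" for P
  proof (rule ccontr)
    assume "\<not> eventually P (filtermap g U)"
    then have "eventually (\<lambda>x. \<not> P x) (filtermap g U)"
      using U by (auto simp: ultrafilter_def eventually_filtermap)
    with P have "eventually (\<lambda>_. False) (inf (nhds L) (filtermap g U))"
      unfolding eventually_inf by blast
    with L show False
      by (simp add: eventually_False)
  qed
  then show ?thesis
    by (auto simp: filterlim_def le_filter_def)
qed


section \<open>Ultraproducts of normed spaces\<close>

locale ultraproduct_family =
  fixes K :: "complex set" and X :: "nat \<Rightarrow> 'a normed_module" and U :: "nat filter"
  assumes space: "\<And>k. normed_space K (X k)"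
    and ultra: "ultrafilter U"
begin

sublocale X: normed_space K "X k" for k
  by (rule space)

abbreviation "L \<equiv> linfty X"
abbreviation "Z \<equiv> ultraproduct U X"

abbreviation cls :: "(nat \<Rightarrow> 'a) \<Rightarrow> (nat \<Rightarrow> 'a) set" where
  "cls x \<equiv> c0_along U X +>\<^bsub>L\<^esub> x"

lemma U_nontrivial: "U \<noteq> bot"
  using ultra by (simp add: ultrafilter_def)

lemma linfty_simps:
  "\<zero>\<^bsub>L\<^esub> = (\<lambda>k. \<zero>\<^bsub>X k\<^esub>)"
  "x \<oplus>\<^bsub>L\<^esub> y = (\<lambda>k. x k \<oplus>\<^bsub>X k\<^esub> y k)"
  "c \<odot>\<^bsub>L\<^esub> x = (\<lambda>k. c \<odot>\<^bsub>X k\<^esub> x k)"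
  by (simp_all add: linfty_def)

lemma linftyI:
  assumes "\<And>k. x k \<in> carrier (X k)" "\<And>k. nrm (X k) (x k) \<le> B"
  shows "x \<in> carrier L"
  using assms by (auto simp: linfty_def intro!: bdd_aboveI2)

lemma linfty_carrierD: "x \<in> carrier L \<Longrightarrow> x k \<in> carrier (X k)"
  by (simp add: linfty_def)

lemma linfty_nrm_le: "x \<in> carrier L \<Longrightarrow> nrm (X k) (x k) \<le> nrm L x"
  by (auto simp: linfty_def intro: cSUP_upper)

lemma linfty_nrm_leI: "(\<And>k. nrm (X k) (x k) \<le> B) \<Longrightarrow> nrm L x \<le> B"
  by (auto simp: linfty_def intro: cSUP_least)

lemma linfty_nrm_nonneg: "x \<in> carrier L \<Longrightarrow> 0 \<le> nrm L x"
  using linfty_nrm_le[of x 0] X.nrm_nonneg[of "x 0" 0] linfty_carrierD[of x 0] by linarith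

lemma linfty_add:
  assumes "x \<in> carrier L" "y \<in> carrier L"
  shows "x \<oplus>\<^bsub>L\<^esub> y \<in> carrier L"
proof (rule linftyI)
  fix k
  show "(x \<oplus>\<^bsub>L\<^esub> y) k \<in> carrier (X k)"
    using assms by (simp add: linfty_simps linfty_carrierD)
  show "nrm (X k) ((x \<oplus>\<^bsub>L\<^esub> y) k) \<le> nrm L x + nrm L y"
    using X.nrm_triangle[OF assms[THEN linfty_carrierD], of k] assms[THEN linfty_nrm_le, of k]
    by (simp add: linfty_simps)
qed

lemma linfty_smult_seq:
  assumes "w \<in> carrier L" "\<And>k. c k \<in> K" "\<And>k. cmod (c k) \<le> B"
  shows "(\<lambda>k. c k \<odot>\<^bsub>X k\<^esub> w k) \<in> carrier L"
proof (rule linftyI)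
  fix k
  show "c k \<odot>\<^bsub>X k\<^esub> w k \<in> carrier (X k)"
    using assms by (simp add: linfty_carrierD)
  have "cmod (c k) * nrm (X k) (w k) \<le> B * nrm L w"
    using assms order_trans[OF norm_ge_zero assms(3)]
    by (intro mult_mono linfty_nrm_le X.nrm_nonneg linfty_carrierD) auto
  then show "nrm (X k) (c k \<odot>\<^bsub>X k\<^esub> w k) \<le> B * nrm L w"
    using assms by (simp add: X.nrm_smult linfty_carrierD)
qed

lemma linfty_smult: "c \<in> K \<Longrightarrow> x \<in> carrier L \<Longrightarrow> c \<odot>\<^bsub>L\<^esub> x \<in> carrier L"
  using linfty_smult_seq[of x "\<lambda>_. c" "cmod c"] by (simp add: linfty_simps)

lemma linfty_zero: "\<zero>\<^bsub>L\<^esub> \<in> carrier L"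
  by (rule linftyI[of _ 0]) (simp_all add: linfty_simps)

lemma linfty_module: "module (scalar_ring K) L"
proof (rule moduleI)
  show "cring (scalar_ring K)"
    by (rule X.R.is_cring)
  show "abelian_group L"
  proof (rule abelian_groupI)
    fix x assume x: "x \<in> carrier L"
    have "((- 1) \<odot>\<^bsub>L\<^esub> x) \<oplus>\<^bsub>L\<^esub> x = \<zero>\<^bsub>L\<^esub>"
      using linfty_carrierD[OF x] X.M.l_neg
      by (simp add: linfty_simps fun_eq_iff flip: X.minus_eq_smult)
    with x show "\<exists>y\<in>carrier L. y \<oplus>\<^bsub>L\<^esub> x = \<zero>\<^bsub>L\<^esub>"
      by (intro bexI[of _ "(- 1) \<odot>\<^bsub>L\<^esub> x"] linfty_smult) simp_all
  qed (use linfty_add linfty_zero in \<open>simp_all add: linfty_simps fun_eq_iff linfty_carrierD X.M.a_ac\<close>)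
qed (simp_all add: X.carrier_scalar_ring linfty_smult,
     simp_all add: scalar_ring_def linfty_simps linfty_carrierD X.smult_add_left
      X.smult_add_right X.smult_mult)

sublocale L: module "scalar_ring K" L
  by (rule linfty_module)

lemma linfty_diff:
  assumes "x \<in> carrier L" "y \<in> carrier L"
  shows "x \<ominus>\<^bsub>L\<^esub> y = (\<lambda>k. x k \<ominus>\<^bsub>X k\<^esub> y k)"
proof -
  have "\<ominus>\<^bsub>L\<^esub> y = (\<lambda>k. \<ominus>\<^bsub>X k\<^esub> y k)"
  proof (rule L.minus_equality)
    show y': "(\<lambda>k. \<ominus>\<^bsub>X k\<^esub> y k) \<in> carrier L"
      using linfty_smult[OF X.minus_one_scalar assms(2)] assms(2)
      by (simp add: linfty_simps linfty_carrierD X.minus_eq_smult)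
    show "(\<lambda>k. \<ominus>\<^bsub>X k\<^esub> y k) \<oplus>\<^bsub>L\<^esub> y = \<zero>\<^bsub>L\<^esub>"
      using assms(2) by (simp add: linfty_simps linfty_carrierD X.M.l_neg)
  qed (fact assms(2))
  then show ?thesis
    by (simp add: a_minus_def linfty_simps)
qed

lemma c0_submodule: "submodule (c0_along U X) (scalar_ring K) L"
proof (rule L.submoduleI)
  show "c0_along U X \<subseteq> carrier L"
    by (auto simp: c0_along_def)
  show "\<zero>\<^bsub>L\<^esub> \<in> c0_along U X"
    by (simp add: c0_along_def linfty_zero) (simp add: linfty_simps)
  have smult: "c \<odot>\<^bsub>L\<^esub> x \<in> c0_along U X" if "c \<in> K" "x \<in> c0_along U X" for c x
  proof -
    have x: "x \<in> carrier L" and "((\<lambda>k. nrm (X k) (x k)) \<longlongrightarrow> 0) U"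
      using that by (auto simp: c0_along_def)
    from tendsto_mult_right_zero[OF this(2), of "cmod c"]
    have "((\<lambda>k. nrm (X k) ((c \<odot>\<^bsub>L\<^esub> x) k)) \<longlongrightarrow> 0) U"
      using that x by (simp add: linfty_simps X.nrm_smult linfty_carrierD)
    then show ?thesis
      using linfty_smult that x by (simp add: c0_along_def)
  qed
  then show "c \<odot>\<^bsub>L\<^esub> x \<in> c0_along U X" if "c \<in> carrier (scalar_ring K)" "x \<in> c0_along U X" for c x
    using that by (simp add: X.carrier_scalar_ring)
  show "\<ominus>\<^bsub>L\<^esub> x \<in> c0_along U X" if x: "x \<in> c0_along U X" for x
  proof -
    have xL: "x \<in> carrier L"
      using x by (simp add: c0_along_def)
    have "\<ominus>\<^bsub>L\<^esub> x = (- 1) \<odot>\<^bsub>L\<^esub> x"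
      using xL by (intro L.minus_equality linfty_smult X.minus_one_scalar)
        (simp_all add: linfty_simps linfty_carrierD X.M.l_neg flip: X.minus_eq_smult)
    then show ?thesis
      using smult[OF X.minus_one_scalar x] by simp
  qed
  show "x \<oplus>\<^bsub>L\<^esub> y \<in> c0_along U X" if x: "x \<in> c0_along U X" and y: "y \<in> c0_along U X" for x y
  proof -
    have L: "x \<in> carrier L" "y \<in> carrier L"
      using x y by (auto simp: c0_along_def)
    have "((\<lambda>k. nrm (X k) (x k) + nrm (X k) (y k)) \<longlongrightarrow> 0) U"
      using x y by (auto simp: c0_along_def intro: tendsto_add_zero)
    then have "((\<lambda>k. nrm (X k) ((x \<oplus>\<^bsub>L\<^esub> y) k)) \<longlongrightarrow> 0) U"
      by (rule tendsto_0_le[where K = 1])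
        (use L in \<open>auto simp: linfty_simps linfty_carrierD X.nrm_nonneg
          intro!: always_eventually X.nrm_triangle order_trans[OF _ abs_ge_self]\<close>)
    then show ?thesis
      using L linfty_add by (simp add: c0_along_def)
  qed
qed

lemma cls_eqI:
  assumes "x \<in> carrier L" "y \<in> carrier L" "((\<lambda>k. nrm (X k) (x k \<ominus>\<^bsub>X k\<^esub> y k)) \<longlongrightarrow> 0) U"
  shows "cls x = cls y"
proof (rule coset_eqI[OF linfty_module c0_submodule assms(1,2)])
  show "x \<ominus>\<^bsub>L\<^esub> y \<in> c0_along U X"
    using assms(3) L.minus_closed[OF assms(1,2)] by (simp add: c0_along_def linfty_diff[OF assms(1,2)])
qed

lemma cls_carrier: "x \<in> carrier L \<Longrightarrow> cls x \<in> carrier Z"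
  unfolding ultraproduct_def by (rule coset_in_quotient_space[OF linfty_module c0_submodule])

lemma ultraproduct_clsE:
  assumes "A \<in> carrier Z"
  obtains x where "x \<in> carrier L" "A = cls x"
  using assms quotient_space_cosetE[OF linfty_module c0_submodule] unfolding ultraproduct_def by blast

lemma cls_add: "x \<in> carrier L \<Longrightarrow> y \<in> carrier L \<Longrightarrow> cls x \<oplus>\<^bsub>Z\<^esub> cls y = cls (x \<oplus>\<^bsub>L\<^esub> y)"
  unfolding ultraproduct_def by (rule coset_add[OF linfty_module c0_submodule])

lemma cls_diff: "x \<in> carrier L \<Longrightarrow> y \<in> carrier L \<Longrightarrow> cls x \<ominus>\<^bsub>Z\<^esub> cls y = cls (x \<ominus>\<^bsub>L\<^esub> y)"
  unfolding ultraproduct_def by (rule coset_diff[OF linfty_module c0_submodule])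

lemma cls_smult: "c \<in> K \<Longrightarrow> x \<in> carrier L \<Longrightarrow> c \<odot>\<^bsub>Z\<^esub> cls x = cls (c \<odot>\<^bsub>L\<^esub> x)"
  unfolding ultraproduct_def
  by (rule coset_smult[OF linfty_module c0_submodule]) (simp_all add: X.carrier_scalar_ring)

lemma nrm_ultraproduct: "nrm Z A = (INF x\<in>A. nrm L x)"
  by (simp add: ultraproduct_def quotient_space_def)

text \<open>
  Let \<open>r\<close> be the limit of the norms. Adding a sequence that is null along \<open>U\<close> does not change \<open>r\<close>,
  so \<open>r\<close> is at most the sup norm of each representative. Conversely, the representative that
  agrees with \<open>x\<close> where the norm is below \<open>r + e\<close> and vanishes elsewhere has sup norm at most
  \<open>r + e\<close>.
\<close>

lemma nrm_cls_tendsto: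
  assumes x: "x \<in> carrier L"
  shows "((\<lambda>k. nrm (X k) (x k)) \<longlongrightarrow> nrm Z (cls x)) U"
proof -
  have nonneg: "0 \<le> nrm (X k) (x k)" for k
    by (intro X.nrm_nonneg linfty_carrierD x)
  obtain r where r: "((\<lambda>k. nrm (X k) (x k)) \<longlongrightarrow> r) U"
    using ultrafilter_bounded_tendsto[OF ultra, of "\<lambda>k. nrm (X k) (x k)" "nrm L x"]
      nonneg linfty_nrm_le[OF x] by auto
  have r0: "0 \<le> r"
    by (rule tendsto_lowerbound[OF r]) (use nonneg U_nontrivial in auto)
  have lower: "r \<le> nrm L y" if y: "y \<in> cls x" for y
  proof -
    obtain h where h: "h \<in> c0_along U X" "y = h \<oplus>\<^bsub>L\<^esub> x"
      using y by (auto simp: a_r_coset_def')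
    then have hL: "h \<in> carrier L"
      by (simp add: c0_along_def)
    have yL: "y \<in> carrier L"
      using h hL x by (simp add: linfty_add)
    have "nrm (X k) (x k) \<le> nrm L y + nrm (X k) (h k)" for k
    proof -
      have hk: "h k \<in> carrier (X k)" and xk: "x k \<in> carrier (X k)" and yk: "y k \<in> carrier (X k)"
        using hL x yL by (simp_all add: linfty_carrierD)
      have "y k \<ominus>\<^bsub>X k\<^esub> h k = x k"
        using hk xk X.M.a_comm[OF hk xk] X.M.a_assoc[OF xk hk X.M.a_inv_closed[OF hk]] X.M.r_neg[OF hk]
        by (simp add: h(2) linfty_simps a_minus_def)
      then show ?thesis
        using X.nrm_diff_le[OF yk hk] linfty_nrm_le[OF yL, of k] by simp
    qed
    moreover have "((\<lambda>k. nrm L y + nrm (X k) (h k)) \<longlongrightarrow> nrm L y + 0) U"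
      using h by (intro tendsto_intros) (simp add: c0_along_def)
    ultimately show ?thesis
      using tendsto_le[OF U_nontrivial _ r] by simp
  qed
  have upper: "nrm Z (cls x) \<le> r + e" if e: "e > 0" for e
  proof -
    define A where "A = {k. nrm (X k) (x k) < r + e}"
    have A: "\<forall>\<^sub>F k in U. k \<in> A"
      using order_tendstoD(2)[OF r, of "r + e"] e by (simp add: A_def)
    \<comment> \<open>adding \<open>h\<close> to \<open>x\<close> replaces the coordinates outside \<open>A\<close> by zero\<close>
    define h where "h k = (if k \<in> A then \<zero>\<^bsub>X k\<^esub> else \<ominus>\<^bsub>X k\<^esub> x k)" for k
    have hL: "h \<in> carrier L"
      using x linfty_nrm_le[OF x] linfty_nrm_nonneg[OF x]
      by (intro linftyI[of _ "nrm L x"]) (auto simp: h_def linfty_carrierD X.nrm_minus)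
    have "((\<lambda>k. nrm (X k) (h k)) \<longlongrightarrow> 0) U"
      by (rule tendsto_eventually, rule eventually_mono[OF A]) (simp add: h_def)
    with hL have "h \<in> c0_along U X"
      by (simp add: c0_along_def)
    then have "h \<oplus>\<^bsub>L\<^esub> x \<in> cls x"
      by (auto simp: a_r_coset_def')
    moreover have "bdd_below (nrm L ` cls x)"
      using lower by (intro bdd_belowI2)
    ultimately have "nrm Z (cls x) \<le> nrm L (h \<oplus>\<^bsub>L\<^esub> x)"
      unfolding nrm_ultraproduct by (intro cINF_lower)
    also have "\<dots> \<le> r + e"
    proof (rule linfty_nrm_leI)
      fix k
      show "nrm (X k) ((h \<oplus>\<^bsub>L\<^esub> x) k) \<le> r + e"
      proof (cases "k \<in> A")
        case True
        then have "nrm (X k) (x k) \<le> r + e" by (simp add: A_def)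
        with True x show ?thesis
          by (simp add: h_def linfty_simps linfty_carrierD)
      next
        case False
        then show ?thesis
          using x e r0 X.M.l_neg[OF linfty_carrierD[OF x]]
          by (simp add: h_def linfty_simps)
      qed
    qed
    finally show ?thesis .
  qed
  have "\<zero>\<^bsub>L\<^esub> \<oplus>\<^bsub>L\<^esub> x \<in> cls x"
    using submodule.axioms(1)[OF c0_submodule] subgroup.one_closed[of "c0_along U X" "add_monoid L"]
    by (auto simp: a_r_coset_def')
  then have "r \<le> nrm Z (cls x)"
    unfolding nrm_ultraproduct using lower by (intro cINF_greatest) auto
  moreover have "nrm Z (cls x) \<le> r"
    using upper by (rule field_le_epsilon)
  ultimately have "nrm Z (cls x) = r"
    by simp
  with r show ?thesis by simp
qed

lemma nrm_cls_le: "x \<in> carrier L \<Longrightarrow> \<forall>\<^sub>F k in U. nrm (X k) (x k) \<le> e \<Longrightarrow> nrm Z (cls x) \<le> e"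
  by (rule tendsto_upperbound[OF nrm_cls_tendsto _ U_nontrivial])

lemma nrm_cls_ge: "x \<in> carrier L \<Longrightarrow> \<forall>\<^sub>F k in U. e \<le> nrm (X k) (x k) \<Longrightarrow> e \<le> nrm Z (cls x)"
  by (rule tendsto_lowerbound[OF nrm_cls_tendsto _ U_nontrivial])

text \<open>
  Coefficients that vary with the coordinate can be replaced by their limit: the error in coordinate
  \<open>k\<close> has norm at most \<open>\<bar>c k - l\<bar>\<close> times the sup norm of \<open>w\<close>. This is what turns coordinatewise
  convex combinations into convex combinations in the ultraproduct.
\<close>

lemma cls_smult_lim:
  assumes w: "w \<in> carrier L" and c: "\<And>k. \<bar>c k\<bar> \<le> B" and lim: "(c \<longlongrightarrow> l) U"
  shows "cls (\<lambda>k. complex_of_real (c k) \<odot>\<^bsub>X k\<^esub> w k) = complex_of_real l \<odot>\<^bsub>Z\<^esub> cls w"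
proof -
  have cwL: "(\<lambda>k. complex_of_real (c k) \<odot>\<^bsub>X k\<^esub> w k) \<in> carrier L"
    by (rule linfty_smult_seq[of _ _ B]) (use w c in auto)
  have "((\<lambda>k. nrm (X k) (complex_of_real (c k) \<odot>\<^bsub>X k\<^esub> w k \<ominus>\<^bsub>X k\<^esub> complex_of_real l \<odot>\<^bsub>X k\<^esub> w k)) \<longlongrightarrow> 0) U"
  proof (rule tendsto_0_le[where K = "nrm L w"])
    show "((\<lambda>k. c k - l) \<longlongrightarrow> 0) U"
      using tendsto_diff[OF lim tendsto_const[of l]] by simp
    show "\<forall>\<^sub>F k in U. norm (nrm (X k) (complex_of_real (c k) \<odot>\<^bsub>X k\<^esub> w k \<ominus>\<^bsub>X k\<^esub> complex_of_real l \<odot>\<^bsub>X k\<^esub> w k))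
        \<le> norm (c k - l) * nrm L w"
    proof (rule always_eventually, rule allI)
      fix k
      have wk: "w k \<in> carrier (X k)"
        using w by (rule linfty_carrierD)
      have "complex_of_real (c k) \<odot>\<^bsub>X k\<^esub> w k \<ominus>\<^bsub>X k\<^esub> complex_of_real l \<odot>\<^bsub>X k\<^esub> w k
          = complex_of_real (c k - l) \<odot>\<^bsub>X k\<^esub> w k"
        using wk by (rule X.smult_diff_left_of_real)
      then have "nrm (X k) (complex_of_real (c k) \<odot>\<^bsub>X k\<^esub> w k \<ominus>\<^bsub>X k\<^esub> complex_of_real l \<odot>\<^bsub>X k\<^esub> w k)
          = \<bar>c k - l\<bar> * nrm (X k) (w k)"
        using X.nrm_smult[OF X.of_real_scalar wk] by (simp only: norm_of_real)
      then show "norm (nrm (X k) (complex_of_real (c k) \<odot>\<^bsub>X k\<^esub> w k \<ominus>\<^bsub>X k\<^esub> complex_of_real l \<odot>\<^bsub>X k\<^esub> w k))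
          \<le> norm (c k - l) * nrm L w"
        using linfty_nrm_le[OF w, of k] X.nrm_nonneg[OF wk] by (simp add: abs_mult mult_left_mono)
    qed
  qed
  then have "cls (\<lambda>k. complex_of_real (c k) \<odot>\<^bsub>X k\<^esub> w k) = cls (complex_of_real l \<odot>\<^bsub>L\<^esub> w)"
    using cwL linfty_smult[OF X.of_real_scalar w, of l] by (intro cls_eqI) (simp_all add: linfty_simps)
  then show ?thesis
    using cls_smult[OF X.of_real_scalar w] by simp
qed


section \<open>Functionals on an ultraproduct\<close>

lemma dual_add: "f \<in> dual K Z \<Longrightarrow> x \<in> carrier L \<Longrightarrow> y \<in> carrier L \<Longrightarrow>
    f (cls (x \<oplus>\<^bsub>L\<^esub> y)) = f (cls x) + f (cls y)"
  by (simp add: dual_def cls_carrier flip: cls_add)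

lemma dual_smult: "f \<in> dual K Z \<Longrightarrow> c \<in> K \<Longrightarrow> x \<in> carrier L \<Longrightarrow> f (cls (c \<odot>\<^bsub>L\<^esub> x)) = c * f (cls x)"
  by (simp add: dual_def cls_carrier flip: cls_smult)

lemma dual_diff: "f \<in> dual K Z \<Longrightarrow> x \<in> carrier L \<Longrightarrow> y \<in> carrier L \<Longrightarrow>
    f (cls (x \<ominus>\<^bsub>L\<^esub> y)) = f (cls x) - f (cls y)"
  using dual_add[of f "x \<ominus>\<^bsub>L\<^esub> y" y] L.minus_closed[of x y] L.a_assoc[of x "\<ominus>\<^bsub>L\<^esub> y" y] L.l_neg[of y]
  by (simp add: a_minus_def)

text \<open>
  The sum is formed separately in each \<open>X k\<close>. That it is again a bounded sequence is part of the
  conclusion, because the induction needs both facts together.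
\<close>

lemma dual_finsum:
  assumes f: "f \<in> dual K Z" and "finite I" "\<And>i. i \<in> I \<Longrightarrow> w i \<in> carrier L"
  shows "(\<lambda>k. \<Oplus>\<^bsub>X k\<^esub>i\<in>I. w i k) \<in> carrier L
    \<and> f (cls (\<lambda>k. \<Oplus>\<^bsub>X k\<^esub>i\<in>I. w i k)) = (\<Sum>i\<in>I. f (cls (w i)))"
  using assms(2,3)
proof (induction I)
  case empty
  have "f (cls \<zero>\<^bsub>L\<^esub>) = 0"
    using dual_smult[OF f, of 0 "\<zero>\<^bsub>L\<^esub>"] X.of_real_scalar[of 0] linfty_zero by (simp add: linfty_simps)
  then show ?case
    using linfty_zero by (simp add: linfty_simps)
next
  case (insert i I)
  have "(\<lambda>k. \<Oplus>\<^bsub>X k\<^esub>i\<in>insert i I. w i k) = w i \<oplus>\<^bsub>L\<^esub> (\<lambda>k. \<Oplus>\<^bsub>X k\<^esub>i\<in>I. w i k)"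
    using insert.hyps insert.prems
    by (auto simp: fun_eq_iff linfty_simps linfty_carrierD intro!: X.M.finsum_insert)
  then show ?case
    using insert dual_add[OF f] linfty_add by simp
qed

text \<open>
  Write a representative of \<open>A\<close> as \<open>r k \<cdot> e k\<close> with \<open>e k\<close> on the sphere. The norms \<open>r k\<close> converge to
  \<open>s = \<parallel>A\<parallel> \<le> 1\<close>, so \<open>A\<close> is \<open>s\<close> times the class of \<open>e\<close>, and \<open>Re (f A)\<close> is at most the absolute value
  of \<open>Re f\<close> at that class. Hence \<open>e\<close> or \<open>-e\<close> will do.
\<close>

lemma sphere_representative:
  assumes f: "f \<in> dual K Z" and nonzero: "\<And>k. carrier (X k) \<noteq> {\<zero>\<^bsub>X k\<^esub>}"
    and A: "A \<in> unit_ball Z"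
  shows "\<exists>x\<in>carrier L. (\<forall>k. x k \<in> unit_sphere (X k)) \<and> Re (f A) \<le> Re (f (cls x))"
proof -
  obtain a where a: "a \<in> carrier L" "A = cls a"
    using A ultraproduct_clsE by (auto simp: unit_ball_def)
  define r where "r k = nrm (X k) (a k)" for k
  define s where "s = nrm Z A"
  have ak: "a k \<in> carrier (X k)" for k
    using a(1) by (rule linfty_carrierD)
  have r: "0 \<le> r k" "\<bar>r k\<bar> \<le> nrm L a" for k
    using X.nrm_nonneg[OF ak] linfty_nrm_le[OF a(1)] by (simp_all add: r_def)
  have r_lim: "(r \<longlongrightarrow> s) U"
    unfolding s_def a(2) r_def using a(1) by (rule nrm_cls_tendsto)
  have s: "0 \<le> s" "s \<le> 1"
    using tendsto_lowerbound[OF r_lim _ U_nontrivial, of 0] r(1) A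
    by (simp_all add: unit_ball_def s_def)
  have "\<exists>e. e \<in> unit_sphere (X k) \<and> a k = complex_of_real (r k) \<odot>\<^bsub>X k\<^esub> e" for k
  proof (cases "r k = 0")
    case True
    \<comment> \<open>any point of the sphere works, and there is one because \<open>X k\<close> is non-zero\<close>
    obtain e where e: "e \<in> unit_sphere (X k)"
      using X.unit_sphere_nonempty[OF nonzero] by blast
    have "a k = \<zero>\<^bsub>X k\<^esub>"
      using True X.nrm_eq_0_iff[OF ak] by (simp add: r_def)
    with True e show ?thesis
      by (auto simp: unit_sphere_def)
  next
    case False
    let ?e = "complex_of_real (inverse (r k)) \<odot>\<^bsub>X k\<^esub> a k"
    have "nrm (X k) ?e = 1"
      using X.nrm_smult[OF X.of_real_scalar ak[of k], of "inverse (r k)"] False r(1)[of k]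
      by (simp add: r_def[symmetric] del: of_real_inverse)
    moreover have "complex_of_real (r k) \<odot>\<^bsub>X k\<^esub> ?e = a k"
      using X.smult_mult[OF X.of_real_scalar X.of_real_scalar ak[of k], of "r k" "inverse (r k)"] False ak
      by simp
    moreover have "?e \<in> carrier (X k)"
      using ak by (rule X.smult_carrier[OF X.of_real_scalar])
    ultimately show ?thesis
      unfolding unit_sphere_def by (intro exI[of _ ?e] conjI CollectI) (assumption | rule sym)+
  qed
  then obtain e where e: "\<And>k. e k \<in> unit_sphere (X k)"
    and a_eq: "\<And>k. a k = complex_of_real (r k) \<odot>\<^bsub>X k\<^esub> e k"
    by metis
  have eL: "e \<in> carrier L"
    using e by (intro linftyI[of _ 1]) (auto simp: unit_sphere_def)
  have "A = cls (complex_of_real s \<odot>\<^bsub>L\<^esub> e)"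
    using cls_smult_lim[OF eL r(2) r_lim] cls_smult[OF X.of_real_scalar eL]
    by (simp add: a(2) flip: a_eq)
  then have fA: "Re (f A) = s * Re (f (cls e))"
    using dual_smult[OF f X.of_real_scalar eL] by simp
  show ?thesis
  proof (cases "0 \<le> Re (f (cls e))")
    case True
    then have "Re (f A) \<le> Re (f (cls e))"
      unfolding fA using s by (simp add: mult_left_le_one_le)
    with e eL show ?thesis by blast
  next
    case False
    let ?e = "(- 1) \<odot>\<^bsub>L\<^esub> e"
    have "?e k \<in> unit_sphere (X k)" for k
      using e[of k] X.nrm_smult[OF X.minus_one_scalar, of "e k" k]
      by (auto simp: unit_sphere_def linfty_simps)
    moreover have "s * Re (f (cls e)) \<le> 0"
      using False s by (simp add: mult_nonneg_nonpos)
    then have "Re (f A) \<le> Re (f (cls ?e))"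
      unfolding fA using False dual_smult[OF f X.minus_one_scalar eL] by simp
    ultimately show ?thesis
      using linfty_smult[OF X.minus_one_scalar eL] by blast
  qed
qed

text \<open>
  The number \<open>n\<close> of summands is the same in all coordinates. Hence the coefficients and the points
  can be arranged into \<open>n\<close> sequences each, and the coefficients \<open>l i\<close> are limits along \<open>U\<close>; limits
  preserve positivity and the finite sum \<open>1\<close>.
\<close>

lemma S_n_set_sequence:
  assumes f: "f \<in> dual K Z" and y: "\<And>k. y k \<in> S_n_set n \<alpha> (X k)"
  obtains l w where "\<forall>i\<in>{1..n}. 0 \<le> l i" "(\<Sum>i=1..n. l i) = 1"
    "\<forall>i\<in>{1..n}. \<forall>k. w i k \<in> S_set \<alpha> (X k)"
    "y \<in> carrier L" "f (cls y) = (\<Sum>i=1..n. complex_of_real (l i) * f (cls (w i)))"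
proof -
  define convex_rep where "convex_rep k l x \<longleftrightarrow>
      y k = (\<Oplus>\<^bsub>X k\<^esub>i\<in>{1..n}. complex_of_real (l i) \<odot>\<^bsub>X k\<^esub> x i)
      \<and> (\<forall>i\<in>{1..n}. l i \<in> {0..1} \<and> x i \<in> S_set \<alpha> (X k)) \<and> (\<Sum>i=1..n. l i) = 1" for k l x
  have "\<exists>l x. convex_rep k l x" for k
    using y[of k] by (auto simp: S_n_set_def conv_n_def convex_rep_def)
  then obtain c w where "\<And>k. convex_rep k (c k) (w k)"
    by metis
  then have y_eq: "\<And>k. y k = (\<Oplus>\<^bsub>X k\<^esub>i\<in>{1..n}. complex_of_real (c k i) \<odot>\<^bsub>X k\<^esub> w k i)"
    and cw: "\<And>k i. i \<in> {1..n} \<Longrightarrow> c k i \<in> {0..1} \<and> w k i \<in> S_set \<alpha> (X k)"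
    and c_sum: "\<And>k. (\<Sum>i=1..n. c k i) = 1"
    unfolding convex_rep_def by simp_all
  have "\<exists>l. ((\<lambda>k. c k i) \<longlongrightarrow> l) U" if "i \<in> {1..n}" for i
    using cw[OF that] by (intro ultrafilter_bounded_tendsto[OF ultra, of _ 1]) auto
  then obtain l where l: "\<And>i. i \<in> {1..n} \<Longrightarrow> ((\<lambda>k. c k i) \<longlongrightarrow> l i) U"
    by metis
  have l_nonneg: "0 \<le> l i" if "i \<in> {1..n}" for i
    by (rule tendsto_lowerbound[OF l[OF that] _ U_nontrivial]) (use cw[OF that] in simp)
  have "((\<lambda>k. \<Sum>i=1..n. c k i) \<longlongrightarrow> (\<Sum>i=1..n. l i)) U"
    by (intro tendsto_sum l)
  then have l_sum: "(\<Sum>i=1..n. l i) = 1"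
    unfolding c_sum tendsto_const_iff[OF U_nontrivial] by (rule sym)
  have wL: "(\<lambda>k. w k i) \<in> carrier L" if "i \<in> {1..n}" for i
    using cw[OF that] X.S_set_unit_ball by (intro linftyI[of _ 1]) (auto simp: unit_ball_def)
  let ?cw = "\<lambda>i k. complex_of_real (c k i) \<odot>\<^bsub>X k\<^esub> w k i"
  have cwL: "?cw i \<in> carrier L" if "i \<in> {1..n}" for i
    by (rule linfty_smult_seq[OF wL[OF that], of _ 1]) (use cw[OF that] in auto)
  have f_cw: "f (cls (?cw i)) = complex_of_real (l i) * f (cls (\<lambda>k. w k i))" if "i \<in> {1..n}" for i
    using cls_smult_lim[OF wL[OF that] _ l[OF that], of 1] cw[OF that]
      dual_smult[OF f X.of_real_scalar wL[OF that], of "l i"] cls_smult[OF X.of_real_scalar wL[OF that], of "l i"]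
    by simp
  have "y = (\<lambda>k. \<Oplus>\<^bsub>X k\<^esub>i\<in>{1..n}. ?cw i k)"
    using y_eq by (rule ext)
  then have "y \<in> carrier L \<and> f (cls y) = (\<Sum>i=1..n. f (cls (?cw i)))"
    using dual_finsum[OF f finite_atLeastAtMost cwL] by simp
  moreover have "(\<Sum>i=1..n. f (cls (?cw i))) = (\<Sum>i=1..n. complex_of_real (l i) * f (cls (\<lambda>k. w k i)))"
    by (intro sum.cong refl f_cw)
  ultimately show thesis
    using that[of l "\<lambda>i k. w k i"] l_nonneg l_sum cw by simp
qed

text \<open>
  If a weighted mean of real numbers exceeds \<open>t\<close>, then so does one of the numbers. Here the numbers
  are the values of \<open>Re f\<close> at classes of sequences of midpoints, and a class of midpoints is the
  midpoint of the classes \<open>a\<close>, \<open>b\<close> of the two sequences of endpoints.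
\<close>

lemma S_n_set_sequence_distant_pair:
  assumes f: "f \<in> dual K Z" and y: "\<And>k. y k \<in> S_n_set n \<alpha> (X k)" and t: "t < Re (f (cls y))"
  obtains a b where "a \<in> unit_ball Z" "b \<in> unit_ball Z" "ndist Z a b \<ge> \<alpha>"
    "2 * t < Re (f a) + Re (f b)"
proof -
  obtain l w where l: "\<forall>i\<in>{1..n}. 0 \<le> l i" "(\<Sum>i=1..n. l i) = 1"
    and w: "\<forall>i\<in>{1..n}. \<forall>k. w i k \<in> S_set \<alpha> (X k)"
    and "y \<in> carrier L"
    and f_y: "f (cls y) = (\<Sum>i=1..n. complex_of_real (l i) * f (cls (w i)))"
    by (rule S_n_set_sequence[OF f y])
  have "\<exists>i\<in>{1..n}. t < Re (f (cls (w i)))"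
  proof (rule ccontr)
    assume "\<not> ?thesis"
    then have "(\<Sum>i=1..n. l i * Re (f (cls (w i)))) \<le> (\<Sum>i=1..n. l i * t)"
      using l(1) by (intro sum_mono mult_left_mono) (auto simp: not_less)
    then show False
      using t l(2) by (simp add: f_y flip: sum_distrib_right)
  qed
  then obtain i where i: "i \<in> {1..n}" "t < Re (f (cls (w i)))"
    by blast
  have "\<exists>u v. u \<in> unit_ball (X k) \<and> v \<in> unit_ball (X k) \<and> \<alpha> \<le> ndist (X k) u v
      \<and> w i k = (1/2) \<odot>\<^bsub>X k\<^esub> (u \<oplus>\<^bsub>X k\<^esub> v)" for k
    using bspec[OF w i(1), THEN spec, of k] unfolding S_set_def by blast
  then obtain u v where u: "\<And>k. u k \<in> unit_ball (X k)" and v: "\<And>k. v k \<in> unit_ball (X k)"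
    and uv: "\<And>k. \<alpha> \<le> ndist (X k) (u k) (v k)"
    and w_eq: "\<And>k. w i k = (1/2) \<odot>\<^bsub>X k\<^esub> (u k \<oplus>\<^bsub>X k\<^esub> v k)"
    by metis
  have L: "u \<in> carrier L" "v \<in> carrier L"
    using u v by (auto simp: unit_ball_def intro!: linftyI[of _ 1])
  have "w i = (1/2) \<odot>\<^bsub>L\<^esub> (u \<oplus>\<^bsub>L\<^esub> v)"
    by (rule ext) (simp add: w_eq linfty_simps)
  then have "f (cls (w i)) = 1/2 * (f (cls u) + f (cls v))"
    using dual_smult[OF f X.half_scalar linfty_add[OF L]] dual_add[OF f L] by simp
  then have "Re (f (cls (w i))) = 1/2 * (Re (f (cls u)) + Re (f (cls v)))"
    by (simp only: mult.commute[of "1/2"] times_divide_eq_right mult_1_right Re_divide_numeral plus_complex.sel)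
  then have "2 * t < Re (f (cls u)) + Re (f (cls v))"
    using i(2) by simp
  moreover have "cls u \<in> unit_ball Z" "cls v \<in> unit_ball Z"
    using L u v by (auto simp: unit_ball_def cls_carrier intro!: nrm_cls_le always_eventually)
  moreover have "\<alpha> \<le> ndist Z (cls u) (cls v)"
    unfolding ndist_def cls_diff[OF L] using uv L.minus_closed[OF L]
    by (intro nrm_cls_ge always_eventually) (simp_all add: linfty_diff[OF L] ndist_def)
  ultimately show thesis
    using that by blast
qed

end


section \<open>Slices of the ball of an ultraproduct\<close>

theorem theorem3p2:
  fixes K :: "complex set" and X :: "nat \<Rightarrow> 'a normed_module"
    and \<alpha> :: real and U :: "nat filter"
  assumes banach: "\<And>k. banach_space K (X k)"
    and nonzero: "\<And>k. carrier (X k) \<noteq> {\<zero>\<^bsub>X k\<^esub>}"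
    and alpha: "0 < \<alpha>" "\<alpha> < 2"
    and U: "free_ultrafilter U"
    and C: "\<And>\<delta>. \<delta> > 0 \<Longrightarrow> \<exists>n\<ge>1. \<forall>\<^sub>F k in U. C_const n \<alpha> (X k) < \<delta>"
  shows "\<forall>S\<in>slices K (ultraproduct U X). \<exists>x\<in>S. \<exists>y\<in>S. ndist (ultraproduct U X) x y \<ge> \<alpha>"
proof
  interpret ultraproduct_family K X U
    using banach U by (intro ultraproduct_family.intro) (auto simp: banach_space_def free_ultrafilter_def)
  fix S assume "S \<in> slices K Z"
  then obtain f \<beta> where f: "f \<in> dual K Z" and \<beta>: "\<beta> > 0"
    and S: "S = {x \<in> unit_ball Z. Re (f x) > (SUP y\<in>unit_ball Z. Re (f y)) - \<beta>}"
    by (auto simp: slices_def)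
  define s where "s = (SUP y\<in>unit_ball Z. Re (f y))"
  \<comment> \<open>positive also for \<open>f = 0\<close>, since \<open>B\<close> is a denominator below\<close>
  obtain B where B: "B > 0" "\<And>a. a \<in> carrier Z \<Longrightarrow> cmod (f a) \<le> B * nrm Z a"
  proof -
    obtain B' where B': "\<And>a. a \<in> carrier Z \<Longrightarrow> cmod (f a) \<le> B' * nrm Z a"
      using f unfolding dual_def by blast
    have "cmod (f a) \<le> (\<bar>B'\<bar> + 1) * nrm Z a" if a: "a \<in> carrier Z" for a
    proof -
      obtain x where x: "x \<in> carrier L" "a = cls x"
        using ultraproduct_clsE[OF a] .
      have "0 \<le> nrm Z a"
        unfolding x(2) using x(1)
        by (intro nrm_cls_ge always_eventually allI X.nrm_nonneg linfty_carrierD)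
      then have "B' * nrm Z a \<le> (\<bar>B'\<bar> + 1) * nrm Z a"
        by (intro mult_right_mono) auto
      with B'[OF a] show ?thesis by simp
    qed
    then show thesis
      using that[of "\<bar>B'\<bar> + 1"] by simp
  qed
  have "Re (f a) \<le> B" if "a \<in> unit_ball Z" for a
  proof -
    have "Re (f a) \<le> B * nrm Z a"
      using complex_Re_le_cmod[of "f a"] B(2)[of a] that by (simp add: unit_ball_def)
    also have "\<dots> \<le> B * 1"
      using that B(1) by (intro mult_left_mono) (auto simp: unit_ball_def)
    finally show ?thesis by simp
  qed
  then have bdd: "bdd_above ((\<lambda>a. Re (f a)) ` unit_ball Z)"
    by (rule bdd_aboveI2)
  then have le_s: "Re (f a) \<le> s" if "a \<in> unit_ball Z" for a
    unfolding s_def using that by (rule cSUP_upper[rotated])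
  have "cls \<zero>\<^bsub>L\<^esub> \<in> unit_ball Z"
    using linfty_zero by (auto simp: unit_ball_def cls_carrier linfty_simps intro!: nrm_cls_le)
  then have ne: "unit_ball Z \<noteq> {}"
    by blast
  have "s - \<beta>/4 < s"
    using \<beta> by simp
  then obtain a where a: "a \<in> unit_ball Z" "s - \<beta>/4 < Re (f a)"
    using less_cSUP_iff[OF ne bdd] unfolding s_def by blast
  obtain x where x: "x \<in> carrier L" "\<And>k. x k \<in> unit_sphere (X k)" "Re (f a) \<le> Re (f (cls x))"
    using sphere_representative[OF f nonzero a(1)] by blast
  \<comment> \<open>moving by \<open>\<delta>\<close> changes \<open>f\<close> by at most \<open>B * \<delta> = \<beta>/4\<close>, so that \<open>Re f\<close> stays above \<open>s - \<beta>/2\<close>\<close>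
  define \<delta> where "\<delta> = \<beta> / (4 * B)"
  have "\<delta> > 0"
    using \<beta> B(1) by (simp add: \<delta>_def)
  from C[OF this] obtain n where n: "n \<ge> 1" "\<forall>\<^sub>F k in U. C_const n \<alpha> (X k) < \<delta>"
    by blast
  \<comment> \<open>for the remaining \<open>k\<close>, an arbitrary point of \<open>S_n_set n \<alpha> (X k)\<close> keeps the representation as a
      convex combination valid in every coordinate\<close>
  have "\<exists>y\<in>S_n_set n \<alpha> (X k). C_const n \<alpha> (X k) < \<delta> \<longrightarrow> ndist (X k) (x k) y < \<delta>" for k
    using X.C_const_approx[OF nonzero _ n(1) _ x(2)] X.S_n_set_nonempty[OF nonzero _ n(1), of \<alpha>] alpha(2)
    by (meson less_imp_le ex_in_conv)
  then obtain y where y: "\<And>k. y k \<in> S_n_set n \<alpha> (X k)"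
    and xy: "\<And>k. C_const n \<alpha> (X k) < \<delta> \<Longrightarrow> ndist (X k) (x k) (y k) < \<delta>"
    by metis
  have yL: "y \<in> carrier L"
    by (rule S_n_set_sequence[OF f y])
  have "nrm Z (cls (x \<ominus>\<^bsub>L\<^esub> y)) \<le> \<delta>"
    using L.minus_closed[OF x(1) yL]
    by (rule nrm_cls_le) (rule eventually_mono[OF n(2)],
      use xy in \<open>auto simp: linfty_diff[OF x(1) yL] ndist_def intro: less_imp_le\<close>)
  then have "B * nrm Z (cls (x \<ominus>\<^bsub>L\<^esub> y)) \<le> \<beta>/4"
    using B(1) by (simp add: \<delta>_def field_simps)
  then have "cmod (f (cls x) - f (cls y)) \<le> \<beta>/4"
    using B(2)[OF cls_carrier[OF L.minus_closed[OF x(1) yL]]] dual_diff[OF f x(1) yL] by simp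
  then have "Re (f (cls x)) - Re (f (cls y)) \<le> \<beta>/4"
    using complex_Re_le_cmod[of "f (cls x) - f (cls y)"] by simp
  with a(2) x(3) have "s - \<beta>/2 < Re (f (cls y))"
    by simp
  then obtain u v where
    uv: "u \<in> unit_ball Z" "v \<in> unit_ball Z" "ndist Z u v \<ge> \<alpha>"
    and f_uv: "2 * (s - \<beta>/2) < Re (f u) + Re (f v)"
    by (rule S_n_set_sequence_distant_pair[OF f y])
  have "s - \<beta> < Re (f u)" "s - \<beta> < Re (f v)"
    using f_uv le_s[OF uv(1)] le_s[OF uv(2)] by simp_all
  with uv have "u \<in> S" "v \<in> S"
    by (simp_all add: S s_def)
  with uv(3) show "\<exists>x\<in>S. \<exists>y\<in>S. ndist Z x y \<ge> \<alpha>"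
    by blast
qed

end
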